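(* Let $M$ be a partial commutative monoid and $(\{\mathbb{E}_m\}_{m\in M},\nabla,\eta)$ an $M$-graded effect monoid. Then $\{D_{\mathbb{E}_m}\}_{m\in M}$ is an $M$-graded monad on $\mathbf{Set}$ with unit $\eta_X: X\to D_{\mathbb{E}_0}X$, $\eta_X(x)=1_{\mathbb{E}_0}\bullet x$, and multiplication $\mu_{m,n}:D_{\mathbb{E}_m}D_{\mathbb{E}_n}\to D_{\mathbb{E}_{m+n}}$ (for $m\perp n$) given by $\mu_{m,n}\big(\sum_i e_i\bullet\Delta_i\big)(x)=\sum_i\nabla_{m,n}(e_i,\Delta_i(x))$.
   Context: A partial commutative monoid (PCM) $\langle M,0,+\rangle$ has a partial, commutative, associative binary operation $+$ (write $a\perp b$ when $a+b$ is defined) with $0\perp a$, $0+a=a$ for all $a$; associativity means: if $b\perp c$ and $a\perp(b+c)$ then $a\perp b$, $(a+b)\perp c$ and $(a+b)+c=a+(b+c)$. An effect algebra is a PCM $\langle\mathbb{E},0,+\rangle$ with a unary operation $e\mapsto e'$ such that $e'$ is the unique element with $e+e'=1$ where $1=0'$, and $e\perp 1$ implies $e=0$; its order is $a\sqsubseteq b$ iff $a+c=b$ for some $c$. Effect morphisms preserve $0$, defined sums and $'$. The category $\mathbf{EA}$ is symmetric monoidal with unit $2=\{0,1\}$, and morphisms $\mathbb{E}_A\otimes\mathbb{E}_B\to\mathbb{E}_C$ correspond to bimorphisms (maps that are PCM homomorphisms in each argument and send $(1,1)$ to $1$). An $M$-graded effect monoid consists of effect algebras $\mathbb{E}_m$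 ($m\in M$), effect morphisms $\nabla_{m,n}:\mathbb{E}_m\otimes\mathbb{E}_n\to\mathbb{E}_{m+n}$ for $m\perp n$ (viewed as bimorphisms), and an effect morphism $\eta:2\to\mathbb{E}_0$, satisfying associativity $\nabla_{m+n,o}(\nabla_{m,n}(a,b),c)=\nabla_{m,n+o}(a,\nabla_{n,o}(b,c))$ and unitality $\nabla_{0,m}(\eta(1),a)=a=\nabla_{m,0}(a,\eta(1))$. For an effect algebra $\mathbb{E}$, $D_{\mathbb{E}}:\mathbf{Set}\to\mathbf{Set}$ sends $X$ to the set of $\Delta:X\to\mathbb{E}$ with finite support $\mathrm{supp}(\Delta)=\{x:\Delta(x)\neq0\}$ such that $\sum_{x\in\mathrm{supp}(\Delta)}\Delta(x)$ is defined (and is $\sqsubseteq 1$), and sends $f:X\to Y$ to $(D_{\mathbb{E}}f)(\Delta)(y)=\sum_{x\in f^{-1}(y)}\Delta(x)$. We write $\sum_i e_i\bullet x_i$ for the distribution assigning $e_i$ to $x_i$. An $M$-graded monad on $\mathbf{Set}$ consists of endofunctors $T_m$ ($m\in M$), a natural transformation $\eta:\mathrm{Id}\to T_0$, and natural transformations $\mu_{m,n}:T_mT_n\to T_{m+n}$ for $m\perp n$, such that $\mu_{m,n+o}\circ T_m\mu_{n,o}=\mu_{m+n,o}\circ\mu_{m,n}T_o$ whenever the grades are orthogonal, and $\mu_{m,0}\circ T_m\eta=\mathrm{id}_{T_m}=\mu_{0,m}\circ\eta T_m$. *)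

theory Defs
  imports "HOL-Library.FuncSet"
begin

section \<open>Partial commutative monoids and effect algebras\<close>

text \<open>
  The partial operation is given by its domain \<open>orth\<close> and by a total function \<open>add\<close>
  whose values are only meaningful on that domain.
\<close>

record 'a pcm =
  carrier :: "'a set"
  pzero :: 'a
  orth :: "'a \<Rightarrow> 'a \<Rightarrow> bool"
  add :: "'a \<Rightarrow> 'a \<Rightarrow> 'a"

locale partial_comm_monoid =
  fixes P :: "('a, 'r) pcm_scheme"
  assumes orth_carrier: "orth P a b \<Longrightarrow> a \<in> carrier P \<and> b \<in> carrier P"
    and add_closed: "orth P a b \<Longrightarrow> add P a b \<in> carrier P"
    and zero_closed: "pzero P \<in> carrier P"
    and zero_left: "a \<in> carrier P \<Longrightarrow> orth P (pzero P) a \<and> add P (pzero P) a = a"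
    and commute: "orth P a b \<Longrightarrow> orth P b a \<and> add P a b = add P b a"
    and assoc: "orth P b c \<Longrightarrow> orth P a (add P b c) \<Longrightarrow>
      orth P a b \<and> orth P (add P a b) c \<and> add P (add P a b) c = add P a (add P b c)"

record 'a effect_alg = "'a pcm" +
  compl :: "'a \<Rightarrow> 'a"

definition one :: "('a, 'r) effect_alg_scheme \<Rightarrow> 'a" where
  "one E = compl E (pzero E)"

locale effect_algebra = partial_comm_monoid E
  for E :: "('a, 'r) effect_alg_scheme" +
  assumes compl_closed: "e \<in> carrier E \<Longrightarrow> compl E e \<in> carrier E"
    and compl_add: "e \<in> carrier E \<Longrightarrow> orth E e (compl E e) \<and> add E e (compl E e) = one E"
    and compl_unique: "orth E e d \<Longrightarrow> add E e d = one E \<Longrightarrow> d = compl E e"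
    and orth_one: "orth E e (one E) \<Longrightarrow> e = pzero E"

definition ea_le :: "('a, 'r) pcm_scheme \<Rightarrow> 'a \<Rightarrow> 'a \<Rightarrow> bool" where
  "ea_le E a b \<longleftrightarrow> (\<exists>c. orth E a c \<and> add E a c = b)"

definition pcm_hom :: "('a, 'r) pcm_scheme \<Rightarrow> ('b, 's) pcm_scheme \<Rightarrow> ('a \<Rightarrow> 'b) \<Rightarrow> bool" where
  "pcm_hom P Q f \<longleftrightarrow>
     (\<forall>a\<in>carrier P. f a \<in> carrier Q) \<and>
     f (pzero P) = pzero Q \<and>
     (\<forall>a b. orth P a b \<longrightarrow> orth Q (f a) (f b) \<and> f (add P a b) = add Q (f a) (f b))"

definition effect_morphism ::
  "('a, 'r) effect_alg_scheme \<Rightarrow> ('b, 's) effect_alg_scheme \<Rightarrow> ('a \<Rightarrow> 'b) \<Rightarrow> bool" where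
  "effect_morphism E F f \<longleftrightarrow>
     pcm_hom E F f \<and> (\<forall>a\<in>carrier E. f (compl E a) = compl F (f a))"

definition bimorphism ::
  "('a, 'r) effect_alg_scheme \<Rightarrow> ('b, 's) effect_alg_scheme \<Rightarrow> ('c, 't) effect_alg_scheme
    \<Rightarrow> ('a \<Rightarrow> 'b \<Rightarrow> 'c) \<Rightarrow> bool" where
  "bimorphism A B C h \<longleftrightarrow>
     (\<forall>a\<in>carrier A. pcm_hom B C (h a)) \<and>
     (\<forall>b\<in>carrier B. pcm_hom A C (\<lambda>a. h a b)) \<and>
     h (one A) (one B) = one C"

text \<open>The effect algebra \<open>2 = {0, 1}\<close>, with \<open>False\<close> as \<open>0\<close> and \<open>True\<close> as \<open>1\<close>.\<close>

definition two :: "bool effect_alg" where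
  "two = \<lparr>carrier = UNIV, pzero = False, orth = (\<lambda>a b. \<not> (a \<and> b)), add = (\<or>), compl = Not\<rparr>"

text \<open>
  A graded family of effect algebras lives in one type \<open>'e\<close>; the carriers of the
  individual members are arbitrary subsets of it. The morphisms out of the tensor products
  are given as bimorphisms.
\<close>

locale graded_effect_monoid = partial_comm_monoid M
  for M :: "('m, 'r) pcm_scheme" +
  fixes E :: "'m \<Rightarrow> ('e, 's) effect_alg_scheme"
    and nabla :: "'m \<Rightarrow> 'm \<Rightarrow> 'e \<Rightarrow> 'e \<Rightarrow> 'e"
    and eta :: "bool \<Rightarrow> 'e"
  assumes effect_algebra: "m \<in> carrier M \<Longrightarrow> effect_algebra (E m)"
    and nabla_bimorphism: "orth M m n \<Longrightarrow> bimorphism (E m) (E n) (E (add M m n)) (nabla m n)"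
    and eta_morphism: "effect_morphism two (E (pzero M)) eta"
    and nabla_assoc: "orth M n p \<Longrightarrow> orth M m (add M n p) \<Longrightarrow>
      a \<in> carrier (E m) \<Longrightarrow> b \<in> carrier (E n) \<Longrightarrow> c \<in> carrier (E p) \<Longrightarrow>
      nabla (add M m n) p (nabla m n a b) c = nabla m (add M n p) a (nabla n p b c)"
    and nabla_unit_left: "m \<in> carrier M \<Longrightarrow> a \<in> carrier (E m) \<Longrightarrow>
      nabla (pzero M) m (eta True) a = a"
    and nabla_unit_right: "m \<in> carrier M \<Longrightarrow> a \<in> carrier (E m) \<Longrightarrow>
      nabla m (pzero M) a (eta True) = a"


section \<open>Distributions\<close>

text \<open>
  \<open>pcm_sums P f A s\<close>: the set \<open>A\<close> is finite, the sum of \<open>f i\<close> over \<open>i \<in> A\<close> is defined in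
  \<open>P\<close>, and its value is \<open>s\<close>. In a partial commutative monoid neither definedness nor the
  value depends on the order of summation.
\<close>

inductive pcm_sums :: "('a, 'r) pcm_scheme \<Rightarrow> ('i \<Rightarrow> 'a) \<Rightarrow> 'i set \<Rightarrow> 'a \<Rightarrow> bool"
  for P :: "('a, 'r) pcm_scheme" and f :: "'i \<Rightarrow> 'a" where
  empty: "pcm_sums P f {} (pzero P)"
| insert: "pcm_sums P f A s \<Longrightarrow> i \<notin> A \<Longrightarrow> orth P (f i) s \<Longrightarrow>
    pcm_sums P f (insert i A) (add P (f i) s)"

definition pcm_sum :: "('a, 'r) pcm_scheme \<Rightarrow> ('i \<Rightarrow> 'a) \<Rightarrow> 'i set \<Rightarrow> 'a" where
  "pcm_sum P f A = (THE s. pcm_sums P f A s)"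

definition supp :: "('e, 's) effect_alg_scheme \<Rightarrow> 'x set \<Rightarrow> ('x \<Rightarrow> 'e) \<Rightarrow> 'x set" where
  "supp E X \<Delta> = {x \<in> X. \<Delta> x \<noteq> pzero E}"

definition dist :: "('e, 's) effect_alg_scheme \<Rightarrow> 'x set \<Rightarrow> ('x \<Rightarrow> 'e) set" where
  "dist E X = {\<Delta> \<in> X \<rightarrow>\<^sub>E carrier E. finite (supp E X \<Delta>) \<and>
     (\<exists>s. pcm_sums E \<Delta> (supp E X \<Delta>) s \<and> ea_le E s (one E))}"

text \<open>
  The sum over a fibre \<open>f\<^sup>-\<^sup>1(y)\<close>, which may be infinite, is the sum over its finitely many
  points in the support.
\<close>

definition dist_map :: "('e, 's) effect_alg_scheme \<Rightarrow> 'x set \<Rightarrow> 'y set \<Rightarrow> ('x \<Rightarrow> 'y)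
    \<Rightarrow> ('x \<Rightarrow> 'e) \<Rightarrow> ('y \<Rightarrow> 'e)" where
  "dist_map E X Y f =
     (\<lambda>\<Delta>\<in>dist E X. \<lambda>y\<in>Y. pcm_sum E \<Delta> {x \<in> supp E X \<Delta>. f x = y})"

definition dist_unit :: "('e, 's) effect_alg_scheme \<Rightarrow> 'x set \<Rightarrow> 'x \<Rightarrow> ('x \<Rightarrow> 'e)" where
  "dist_unit E X = (\<lambda>x\<in>X. \<lambda>y\<in>X. if y = x then one E else pzero E)"

text \<open>
  The formal sum of the \<open>e\<^sub>i \<bullet> \<Delta>\<^sub>i\<close> is a distribution \<open>\<Phi>\<close> on distributions: the
  \<open>\<Delta>\<^sub>i\<close> are the points of its support and \<open>e\<^sub>i = \<Phi> \<Delta>\<^sub>i\<close>.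
\<close>

definition dist_mult :: "('e, 's) effect_alg_scheme \<Rightarrow> ('e, 's) effect_alg_scheme
    \<Rightarrow> ('e, 's) effect_alg_scheme \<Rightarrow> ('e \<Rightarrow> 'e \<Rightarrow> 'e) \<Rightarrow> 'x set
    \<Rightarrow> (('x \<Rightarrow> 'e) \<Rightarrow> 'e) \<Rightarrow> ('x \<Rightarrow> 'e)" where
  "dist_mult A B C h X =
     (\<lambda>\<Phi>\<in>dist A (dist B X). \<lambda>x\<in>X.
        pcm_sum C (\<lambda>\<Delta>. h (\<Phi> \<Delta>) (\<Delta> x)) (supp A (dist B X) \<Phi>))"

definition D :: "('m \<Rightarrow> ('e, 's) effect_alg_scheme) \<Rightarrow> 'm \<Rightarrow> 'x set \<Rightarrow> ('x \<Rightarrow> 'e) set" where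
  "D E m = dist (E m)"

definition D_map :: "('m \<Rightarrow> ('e, 's) effect_alg_scheme) \<Rightarrow> 'm \<Rightarrow> 'x set \<Rightarrow> 'y set
    \<Rightarrow> ('x \<Rightarrow> 'y) \<Rightarrow> ('x \<Rightarrow> 'e) \<Rightarrow> ('y \<Rightarrow> 'e)" where
  "D_map E m = dist_map (E m)"

definition D_unit :: "('m, 'r) pcm_scheme \<Rightarrow> ('m \<Rightarrow> ('e, 's) effect_alg_scheme) \<Rightarrow> 'x set
    \<Rightarrow> 'x \<Rightarrow> ('x \<Rightarrow> 'e)" where
  "D_unit M E = dist_unit (E (pzero M))"

definition D_mult :: "('m, 'r) pcm_scheme \<Rightarrow> ('m \<Rightarrow> ('e, 's) effect_alg_scheme)
    \<Rightarrow> ('m \<Rightarrow> 'm \<Rightarrow> 'e \<Rightarrow> 'e \<Rightarrow> 'e) \<Rightarrow> 'm \<Rightarrow> 'm \<Rightarrow> 'x set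
    \<Rightarrow> (('x \<Rightarrow> 'e) \<Rightarrow> 'e) \<Rightarrow> ('x \<Rightarrow> 'e)" where
  "D_mult M E nabla m n = dist_mult (E m) (E n) (E (add M m n)) (nabla m n)"


section \<open>Graded monads on Set\<close>

text \<open>
  The objects of Set are the sets \<open>X :: 'a set\<close> over all types \<open>'a\<close>; the morphisms from \<open>X\<close>
  to \<open>Y\<close> are the elements of \<open>X \<rightarrow>\<^sub>E Y\<close>, composed by \<open>compose X g f\<close>, so that equality of
  morphisms is equality in HOL.

  An endofunctor, a natural transformation or a monad is a family over all types. HOL has no
  variables for such families. The definitions below therefore state the axioms at fixed
  types of objects and take one argument for each type at which a component is needed; a
  subscript names that type. Applied to polymorphic constants, with all type
  variables schematic, they express the axioms at all objects.
\<close>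

definition set_functor ::
  "('a set \<Rightarrow> 'fa set) \<Rightarrow> ('b set \<Rightarrow> 'fb set) \<Rightarrow> ('c set \<Rightarrow> 'fc set) \<Rightarrow>
   ('a set \<Rightarrow> 'a set \<Rightarrow> ('a \<Rightarrow> 'a) \<Rightarrow> 'fa \<Rightarrow> 'fa) \<Rightarrow>
   ('a set \<Rightarrow> 'b set \<Rightarrow> ('a \<Rightarrow> 'b) \<Rightarrow> 'fa \<Rightarrow> 'fb) \<Rightarrow>
   ('b set \<Rightarrow> 'c set \<Rightarrow> ('b \<Rightarrow> 'c) \<Rightarrow> 'fb \<Rightarrow> 'fc) \<Rightarrow>
   ('a set \<Rightarrow> 'c set \<Rightarrow> ('a \<Rightarrow> 'c) \<Rightarrow> 'fa \<Rightarrow> 'fc) \<Rightarrow> bool" where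
  "set_functor F\<^sub>a F\<^sub>b F\<^sub>c F\<^sub>a\<^sub>a F\<^sub>a\<^sub>b F\<^sub>b\<^sub>c F\<^sub>a\<^sub>c \<longleftrightarrow>
     (\<forall>X Y. \<forall>f \<in> X \<rightarrow>\<^sub>E Y. F\<^sub>a\<^sub>b X Y f \<in> F\<^sub>a X \<rightarrow>\<^sub>E F\<^sub>b Y) \<and>
     (\<forall>X. F\<^sub>a\<^sub>a X X (\<lambda>x\<in>X. x) = (\<lambda>u\<in>F\<^sub>a X. u)) \<and>
     (\<forall>X Y Z. \<forall>f \<in> X \<rightarrow>\<^sub>E Y. \<forall>g \<in> Y \<rightarrow>\<^sub>E Z.
        F\<^sub>a\<^sub>c X Z (compose X g f) = compose (F\<^sub>a X) (F\<^sub>b\<^sub>c Y Z g) (F\<^sub>a\<^sub>b X Y f))"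

definition natural_trans ::
  "('a set \<Rightarrow> 'fa set) \<Rightarrow> ('b set \<Rightarrow> 'fb set) \<Rightarrow>
   ('a set \<Rightarrow> 'b set \<Rightarrow> ('a \<Rightarrow> 'b) \<Rightarrow> 'fa \<Rightarrow> 'fb) \<Rightarrow>
   ('a set \<Rightarrow> 'ga set) \<Rightarrow> ('b set \<Rightarrow> 'gb set) \<Rightarrow>
   ('a set \<Rightarrow> 'b set \<Rightarrow> ('a \<Rightarrow> 'b) \<Rightarrow> 'ga \<Rightarrow> 'gb) \<Rightarrow>
   ('a set \<Rightarrow> 'fa \<Rightarrow> 'ga) \<Rightarrow> ('b set \<Rightarrow> 'fb \<Rightarrow> 'gb) \<Rightarrow> bool" where
  "natural_trans F\<^sub>a F\<^sub>b F\<^sub>a\<^sub>b G\<^sub>a G\<^sub>b G\<^sub>a\<^sub>b \<alpha>\<^sub>a \<alpha>\<^sub>b \<longleftrightarrow>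
     (\<forall>X. \<alpha>\<^sub>a X \<in> F\<^sub>a X \<rightarrow>\<^sub>E G\<^sub>a X) \<and>
     (\<forall>Y. \<alpha>\<^sub>b Y \<in> F\<^sub>b Y \<rightarrow>\<^sub>E G\<^sub>b Y) \<and>
     (\<forall>X Y. \<forall>f \<in> X \<rightarrow>\<^sub>E Y.
        compose (F\<^sub>a X) (G\<^sub>a\<^sub>b X Y f) (\<alpha>\<^sub>a X) = compose (F\<^sub>a X) (\<alpha>\<^sub>b Y) (F\<^sub>a\<^sub>b X Y f))"

text \<open>
  The subscripts \<open>ta\<close>, \<open>tb\<close> and \<open>tta\<close> denote the types of \<open>T\<^sub>m X\<close>, \<open>T\<^sub>m Y\<close> and
  \<open>T\<^sub>m (T\<^sub>n X)\<close> for \<open>X :: 'a set\<close> and \<open>Y :: 'b set\<close>. Thus \<open>T\<^sub>t\<^sub>a m (T\<^sub>a n X)\<close> is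
  the iterated application to \<open>X\<close>, and \<open>T\<^sub>t\<^sub>t\<^sub>a\<^sub>_\<^sub>t\<^sub>a\<close> is the action on functions from
  type \<open>'tta\<close> to type \<open>'ta\<close>.
\<close>

definition graded_monad ::
  "('m, 'r) pcm_scheme \<Rightarrow>
   ('m \<Rightarrow> 'a set \<Rightarrow> 'ta set) \<Rightarrow> ('m \<Rightarrow> 'b set \<Rightarrow> 'tb set) \<Rightarrow> ('m \<Rightarrow> 'c set \<Rightarrow> 'tc set) \<Rightarrow>
   ('m \<Rightarrow> 'ta set \<Rightarrow> 'tta set) \<Rightarrow> ('m \<Rightarrow> 'tb set \<Rightarrow> 'ttb set) \<Rightarrow> ('m \<Rightarrow> 'tta set \<Rightarrow> 'ttta set) \<Rightarrow>
   ('m \<Rightarrow> 'a set \<Rightarrow> 'a set \<Rightarrow> ('a \<Rightarrow> 'a) \<Rightarrow> 'ta \<Rightarrow> 'ta) \<Rightarrow>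
   ('m \<Rightarrow> 'a set \<Rightarrow> 'b set \<Rightarrow> ('a \<Rightarrow> 'b) \<Rightarrow> 'ta \<Rightarrow> 'tb) \<Rightarrow>
   ('m \<Rightarrow> 'b set \<Rightarrow> 'c set \<Rightarrow> ('b \<Rightarrow> 'c) \<Rightarrow> 'tb \<Rightarrow> 'tc) \<Rightarrow>
   ('m \<Rightarrow> 'a set \<Rightarrow> 'c set \<Rightarrow> ('a \<Rightarrow> 'c) \<Rightarrow> 'ta \<Rightarrow> 'tc) \<Rightarrow>
   ('m \<Rightarrow> 'ta set \<Rightarrow> 'tb set \<Rightarrow> ('ta \<Rightarrow> 'tb) \<Rightarrow> 'tta \<Rightarrow> 'ttb) \<Rightarrow>
   ('m \<Rightarrow> 'a set \<Rightarrow> 'ta set \<Rightarrow> ('a \<Rightarrow> 'ta) \<Rightarrow> 'ta \<Rightarrow> 'tta) \<Rightarrow>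
   ('m \<Rightarrow> 'tta set \<Rightarrow> 'ta set \<Rightarrow> ('tta \<Rightarrow> 'ta) \<Rightarrow> 'ttta \<Rightarrow> 'tta) \<Rightarrow>
   ('a set \<Rightarrow> 'a \<Rightarrow> 'ta) \<Rightarrow> ('b set \<Rightarrow> 'b \<Rightarrow> 'tb) \<Rightarrow> ('ta set \<Rightarrow> 'ta \<Rightarrow> 'tta) \<Rightarrow>
   ('m \<Rightarrow> 'm \<Rightarrow> 'a set \<Rightarrow> 'tta \<Rightarrow> 'ta) \<Rightarrow>
   ('m \<Rightarrow> 'm \<Rightarrow> 'b set \<Rightarrow> 'ttb \<Rightarrow> 'tb) \<Rightarrow>
   ('m \<Rightarrow> 'm \<Rightarrow> 'ta set \<Rightarrow> 'ttta \<Rightarrow> 'tta) \<Rightarrow> bool" where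
  "graded_monad M T\<^sub>a T\<^sub>b T\<^sub>c T\<^sub>t\<^sub>a T\<^sub>t\<^sub>b T\<^sub>t\<^sub>t\<^sub>a
      T\<^sub>a\<^sub>_\<^sub>a T\<^sub>a\<^sub>_\<^sub>b T\<^sub>b\<^sub>_\<^sub>c T\<^sub>a\<^sub>_\<^sub>c T\<^sub>t\<^sub>a\<^sub>_\<^sub>t\<^sub>b T\<^sub>a\<^sub>_\<^sub>t\<^sub>a T\<^sub>t\<^sub>t\<^sub>a\<^sub>_\<^sub>t\<^sub>a
      \<eta>\<^sub>a \<eta>\<^sub>b \<eta>\<^sub>t\<^sub>a \<mu>\<^sub>a \<mu>\<^sub>b \<mu>\<^sub>t\<^sub>a \<longleftrightarrow>
     partial_comm_monoid M \<and>
     (\<forall>m\<in>carrier M.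
        set_functor (T\<^sub>a m) (T\<^sub>b m) (T\<^sub>c m) (T\<^sub>a\<^sub>_\<^sub>a m) (T\<^sub>a\<^sub>_\<^sub>b m) (T\<^sub>b\<^sub>_\<^sub>c m) (T\<^sub>a\<^sub>_\<^sub>c m)) \<and>
     natural_trans (\<lambda>X. X) (\<lambda>Y. Y) (\<lambda>X Y f. f)
       (T\<^sub>a (pzero M)) (T\<^sub>b (pzero M)) (T\<^sub>a\<^sub>_\<^sub>b (pzero M)) \<eta>\<^sub>a \<eta>\<^sub>b \<and>
     (\<forall>m n. orth M m n \<longrightarrow>
        natural_trans
          (\<lambda>X. T\<^sub>t\<^sub>a m (T\<^sub>a n X)) (\<lambda>Y. T\<^sub>t\<^sub>b m (T\<^sub>b n Y))
          (\<lambda>X Y f. T\<^sub>t\<^sub>a\<^sub>_\<^sub>t\<^sub>b m (T\<^sub>a n X) (T\<^sub>b n Y) (T\<^sub>a\<^sub>_\<^sub>b n X Y f))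
          (T\<^sub>a (add M m n)) (T\<^sub>b (add M m n)) (T\<^sub>a\<^sub>_\<^sub>b (add M m n)) (\<mu>\<^sub>a m n) (\<mu>\<^sub>b m n)) \<and>
     (\<forall>m n p X. orth M n p \<and> orth M m (add M n p) \<longrightarrow>
        compose (T\<^sub>t\<^sub>t\<^sub>a m (T\<^sub>t\<^sub>a n (T\<^sub>a p X)))
          (\<mu>\<^sub>a m (add M n p) X)
          (T\<^sub>t\<^sub>t\<^sub>a\<^sub>_\<^sub>t\<^sub>a m (T\<^sub>t\<^sub>a n (T\<^sub>a p X)) (T\<^sub>a (add M n p) X) (\<mu>\<^sub>a n p X)) =
        compose (T\<^sub>t\<^sub>t\<^sub>a m (T\<^sub>t\<^sub>a n (T\<^sub>a p X)))
          (\<mu>\<^sub>a (add M m n) p X)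
          (\<mu>\<^sub>t\<^sub>a m n (T\<^sub>a p X))) \<and>
     (\<forall>m\<in>carrier M. \<forall>X.
        compose (T\<^sub>a m X) (\<mu>\<^sub>a m (pzero M) X) (T\<^sub>a\<^sub>_\<^sub>t\<^sub>a m X (T\<^sub>a (pzero M) X) (\<eta>\<^sub>a X)) =
          (\<lambda>u\<in>T\<^sub>a m X. u) \<and>
        compose (T\<^sub>a m X) (\<mu>\<^sub>a (pzero M) m X) (\<eta>\<^sub>t\<^sub>a (T\<^sub>a m X)) = (\<lambda>u\<in>T\<^sub>a m X. u))"

end

(*
  Finite sums in an effect algebra are invariant under regrouping and reordering. Functoriality
  and the naturality, associativity and unit laws are therefore instances of Fubini for finite
  double sums, once the double sums are known to be defined: those of
  nabla (\<Phi> \<Delta>) (\<Delta> x) over \<Delta> and x are dominated by the sum of nabla (\<Phi> \<Delta>) 1 over \<Delta>, which is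
  defined because nabla is additive in its first argument.
*)
theory Submission
  imports Defs
begin

section \<open>Sums in an effect algebra\<close>

text \<open>The obstacle is definedness: an equation between partial sums means something only once
  every sum in it exists, and \<open>pcm_sums\<close> builds a sum along one order of insertion.
  Passing to a total monoid removes both problems. There every finite sum exists, and undefinedness
  is just the value \<open>None\<close>, so regrouping and exchange become equivalences: a total
  known to exist on either side yields the other. Supports are a second difficulty. A bimorphism may
  send two nonzero elements to zero, as the meet of a Boolean algebra does, so the support of a
  multiplied distribution is only bounded by a union of supports, not computed. Sums are therefore
  taken over arbitrary finite index sets that contain the support. Two distributions are compared at
  a point by exhibiting both values as sums of one family, since the value of a sum is
  unique.\<close>

definition oplus :: "('a, 'r) pcm_scheme \<Rightarrow> 'a option \<Rightarrow> 'a option \<Rightarrow> 'a option" where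
  "oplus P u v =
     (if u = Some (pzero P) then v else if v = Some (pzero P) then u
      else case u of None \<Rightarrow> None | Some a \<Rightarrow>
        (case v of None \<Rightarrow> None | Some b \<Rightarrow> if orth P a b then Some (add P a b) else None))"

context effect_algebra
begin

lemma one_closed: "one E \<in> carrier E"
  unfolding one_def by (simp add: compl_closed zero_closed)

lemma zero_right: "a \<in> carrier E \<Longrightarrow> orth E a (pzero E) \<and> add E a (pzero E) = a"
  using commute zero_left by metis

text \<open>The axiom \<open>assoc\<close> rebrackets in one direction only; commuting both
  additions gives the other.\<close>

lemma assoc_right:
  "orth E a b \<Longrightarrow> orth E (add E a b) c \<Longrightarrow>
    orth E b c \<and> orth E a (add E b c) \<and> add E a (add E b c) = add E (add E a b) c"
  using assoc[of b a c] commute by metis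

text \<open>As 1 is orthogonal to 0 = a + b, associativity makes 1 orthogonal to a, which
  \<open>orth_one\<close> permits only for a = 0.\<close>

lemma add_eq_zero: "orth E a b \<Longrightarrow> add E a b = pzero E \<Longrightarrow> a = pzero E"
  using assoc[of a b "one E"] commute orth_one zero_right one_closed by metis

text \<open>The complement is the witness. This supplies the bound that \<open>dist\<close> asks
  for.\<close>

lemma ea_le_one: "s \<in> carrier E \<Longrightarrow> ea_le E s (one E)"
  unfolding ea_le_def using compl_add by blast

lemma oplus_commute: "oplus E u v = oplus E v u"
proof (cases u; cases v)
  fix a b assume "u = Some a" "v = Some b"
  moreover have "(if orth E a b then Some (add E a b) else None)
      = (if orth E b a then Some (add E b a) else None)"
    using commute[of a b] commute[of b a] by (intro if_cong) auto
  ultimately show ?thesis unfolding oplus_def by simp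
qed (auto simp: oplus_def)

lemma oplus_assoc: "oplus E (oplus E u v) w = oplus E u (oplus E v w)"
proof (cases "u = None \<or> v = None \<or> w = None \<or>
    u = Some (pzero E) \<or> v = Some (pzero E) \<or> w = Some (pzero E)")
  case True
  then show ?thesis
    unfolding oplus_def by (auto split: option.splits)
next
  case False
  then obtain a b c where abc: "u = Some a" "v = Some b" "w = Some c"
    and nz: "a \<noteq> pzero E" "b \<noteq> pzero E" "c \<noteq> pzero E" by auto
  \<comment> \<open>Keeps the outer \<open>oplus\<close> out of its zero clauses, which would bypass
    the orthogonality test.\<close>
  have nz': "orth E a b \<Longrightarrow> add E a b \<noteq> pzero E" "orth E b c \<Longrightarrow> add E b c \<noteq> pzero E"
    using nz add_eq_zero by blast+
  have "oplus E (oplus E u v) w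
      = (if orth E a b \<and> orth E (add E a b) c then Some (add E (add E a b) c) else None)"
    using nz nz'(1) unfolding oplus_def abc by simp
  also have "\<dots>
      = (if orth E b c \<and> orth E a (add E b c) then Some (add E a (add E b c)) else None)"
    using assoc[of b c a] assoc_right[of a b c] by (intro if_cong) auto
  also have "\<dots> = oplus E u (oplus E v w)"
    using nz nz'(2) unfolding oplus_def abc by simp
  finally show ?thesis .
qed

text \<open>
  With \<open>None\<close> for an undefined sum, an effect algebra is a total commutative monoid, so
  that the library of finite sums applies. The unit law on elements outside the carrier
  is forced by the definition of \<open>oplus\<close>; associativity survives because sums of nonzero
  elements are nonzero.
\<close>

sublocale osum: comm_monoid_set "oplus E" "Some (pzero E)"
proof unfold_locales
  show "oplus E a (Some (pzero E)) = a" for a by (simp add: oplus_def)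
qed (rule oplus_assoc oplus_commute)+

lemma oplus_Some:
  "a \<in> carrier E \<Longrightarrow> b \<in> carrier E \<Longrightarrow>
    oplus E (Some a) (Some b) = (if orth E a b then Some (add E a b) else None)"
  unfolding oplus_def using zero_left zero_right by auto

lemma oplus_defined:
  "oplus E u v = Some s \<Longrightarrow> u \<noteq> None \<and> v \<noteq> None"
  unfolding oplus_def by (auto split: option.splits if_splits)

section \<open>The sum relation as a sum in the total monoid\<close>

lemma pcm_sums_D:
  assumes "pcm_sums E f A s"
  shows "finite A" "f ` A \<subseteq> carrier E" "s \<in> carrier E"
    "osum.F (\<lambda>i. Some (f i)) A = Some s"
  using assms
proof induction
  case empty
  { case 1 show ?case by simp next
    case 2 show ?case by simp next
    case 3 show ?case by (rule zero_closed) next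
    case 4 show ?case by simp }
next
  case (insert A s i)
  { case 1 show ?case using insert by simp next
    case 2 show ?case using insert orth_carrier by auto next
    case 3 show ?case using insert add_closed by auto next
    case 4 show ?case using insert oplus_Some orth_carrier by simp }
qed

lemma pcm_sums_I:
  "finite A \<Longrightarrow> f ` A \<subseteq> carrier E \<Longrightarrow> osum.F (\<lambda>i. Some (f i)) A = Some s
    \<Longrightarrow> pcm_sums E f A s"
proof (induction A arbitrary: s rule: finite_induct)
  case empty
  then show ?case using pcm_sums.empty by auto
next
  case (insert i A)
  have eq: "oplus E (Some (f i)) (osum.F (\<lambda>i. Some (f i)) A) = Some s"
    using insert by simp
  then obtain t where t: "osum.F (\<lambda>i. Some (f i)) A = Some t"
    using oplus_defined by blast
  then have p: "pcm_sums E f A t" using insert by auto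
  have "orth E (f i) t" "s = add E (f i) t"
    using eq t oplus_Some[of "f i" t] pcm_sums_D(3)[OF p] insert.prems
    by (auto split: if_splits)
  then show ?case using pcm_sums.insert[OF p] insert by auto
qed

text \<open>The carrier condition separates the two notions: a one-element sum in the total monoid
  returns any value whatsoever, whereas \<open>pcm_sums\<close> tests orthogonality and hence
  membership.\<close>

lemma pcm_sums_iff:
  "pcm_sums E f A s \<longleftrightarrow>
    finite A \<and> f ` A \<subseteq> carrier E \<and> osum.F (\<lambda>i. Some (f i)) A = Some s"
  by (intro iffI conjI pcm_sums_I) (elim pcm_sums_D conjE; assumption)+

lemma pcm_sums_unique: "pcm_sums E f A s \<Longrightarrow> pcm_sums E f A t \<Longrightarrow> s = t"
  by (simp add: pcm_sums_iff)

lemma pcm_sum_eq: "pcm_sums E f A s \<Longrightarrow> pcm_sum E f A = s"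
  unfolding pcm_sum_def using pcm_sums_unique by blast

lemma pcm_sums_cong:
  assumes "A = B" "\<And>i. i \<in> B \<Longrightarrow> f i = g i"
  shows "pcm_sums E f A s \<longleftrightarrow> pcm_sums E g B s"
proof -
  have "f ` A = g ` B" using assms by (intro image_cong)
  moreover have "osum.F (\<lambda>i. Some (f i)) A = osum.F (\<lambda>i. Some (g i)) B"
    using assms by (intro osum.cong) auto
  ultimately show ?thesis using assms(1) by (simp add: pcm_sums_iff)
qed

section \<open>Restriction, comparison, regrouping and exchange of sums\<close>

lemma pcm_sums_singleton: "f i \<in> carrier E \<Longrightarrow> pcm_sums E f {i} s \<longleftrightarrow> s = f i"
  by (auto simp: pcm_sums_iff)

lemma pcm_sums_mono_neutral:
  assumes "finite B" "A \<subseteq> B" "\<And>i. i \<in> B - A \<Longrightarrow> f i = pzero E"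
  shows "pcm_sums E f A s \<longleftrightarrow> pcm_sums E f B s"
proof -
  have "osum.F (\<lambda>i. Some (f i)) A = osum.F (\<lambda>i. Some (f i)) B"
    using assms by (intro osum.mono_neutral_left) auto
  moreover have "f ` A \<subseteq> carrier E \<longleftrightarrow> f ` B \<subseteq> carrier E"
    using assms zero_closed by fastforce
  ultimately show ?thesis
    using assms finite_subset by (auto simp: pcm_sums_iff)
qed

text \<open>\<open>None\<close> is absorbing, so a defined total has defined partial sums.\<close>

lemma pcm_sums_subset:
  assumes "pcm_sums E f A s" "B \<subseteq> A"
  shows "\<exists>t. pcm_sums E f B t"
proof -
  have "oplus E (osum.F (\<lambda>i. Some (f i)) (A - B)) (osum.F (\<lambda>i. Some (f i)) B) = Some s"
    using osum.subset_diff[OF assms(2)] assms(1) by (simp add: pcm_sums_iff)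
  then obtain t where "osum.F (\<lambda>i. Some (f i)) B = Some t"
    using oplus_defined by blast
  moreover have "finite B" "f ` B \<subseteq> carrier E"
    using pcm_sums_D(1,2)[OF assms(1)] assms(2) finite_subset by blast+
  ultimately show ?thesis by (auto simp: pcm_sums_iff)
qed

text \<open>Split each f i into g i and a remainder r i. The total of f is then the total of g plus
  that of r, and both parts of a defined sum are defined.\<close>

lemma pcm_sums_summand_le:
  assumes s: "pcm_sums E f A s"
    and le: "\<And>i. i \<in> A \<Longrightarrow> ea_le E (g i) (f i)"
  shows "\<exists>t. pcm_sums E g A t"
proof -
  obtain r where r: "\<And>i. i \<in> A \<Longrightarrow> orth E (g i) (r i) \<and> add E (g i) (r i) = f i"
    using le unfolding ea_le_def by metis
  have "osum.F (\<lambda>i. Some (f i)) A = osum.F (\<lambda>i. oplus E (Some (g i)) (Some (r i))) A"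
  proof (intro osum.cong refl)
    fix i assume "i \<in> A"
    then show "Some (f i) = oplus E (Some (g i)) (Some (r i))"
      using r[of i] orth_carrier[of "g i" "r i"] by (simp add: oplus_Some)
  qed
  then have "oplus E (osum.F (\<lambda>i. Some (g i)) A) (osum.F (\<lambda>i. Some (r i)) A) = Some s"
    using s by (simp add: osum.distrib pcm_sums_iff)
  then obtain t where "osum.F (\<lambda>i. Some (g i)) A = Some t"
    using oplus_defined by blast
  moreover have "g ` A \<subseteq> carrier E" using r orth_carrier by blast
  ultimately show ?thesis using s by (auto simp: pcm_sums_iff)
qed

text \<open>Regrouping is unconditional in the total monoid. Hence, given the fibre sums, the total
  over A exists exactly when the total over B does.\<close>

lemma pcm_sums_group:
  assumes "finite A" "finite B" "g ` A \<subseteq> B"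
    and F: "\<And>y. y \<in> B \<Longrightarrow> pcm_sums E f {x \<in> A. g x = y} (F y)"
  shows "pcm_sums E F B s \<longleftrightarrow> pcm_sums E f A s"
proof -
  have "osum.F (\<lambda>y. Some (F y)) B
      = osum.F (\<lambda>y. osum.F (\<lambda>x. Some (f x)) {x \<in> A. g x = y}) B"
    using pcm_sums_D(4)[OF F] by (intro osum.cong) auto
  also have "\<dots> = osum.F (\<lambda>x. Some (f x)) A"
    using assms by (intro osum.group) auto
  finally have "osum.F (\<lambda>y. Some (F y)) B = osum.F (\<lambda>x. Some (f x)) A" .
  moreover have "f ` A \<subseteq> carrier E" using pcm_sums_D(2)[OF F] assms(3) by blast
  moreover have "F ` B \<subseteq> carrier E" using pcm_sums_D(3)[OF F] by blast
  ultimately show ?thesis using assms by (simp add: pcm_sums_iff)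
qed

lemma pcm_sums_Times:
  assumes "finite A" "finite B"
    and r: "\<And>i. i \<in> A \<Longrightarrow> pcm_sums E (f i) B (r i)"
  shows "pcm_sums E r A s \<longleftrightarrow> pcm_sums E (\<lambda>(i, j). f i j) (A \<times> B) s"
proof -
  have "osum.F (\<lambda>i. Some (r i)) A = osum.F (\<lambda>i. osum.F (\<lambda>j. Some (f i j)) B) A"
    using pcm_sums_D(4)[OF r] by (intro osum.cong) auto
  also have "\<dots> = osum.F (\<lambda>(i, j). Some (f i j)) (A \<times> B)"
    by (rule osum.cartesian_product)
  finally have "osum.F (\<lambda>i. Some (r i)) A = osum.F (\<lambda>p. Some (case p of (i, j) \<Rightarrow> f i j)) (A \<times> B)"
    by (simp add: case_prod_unfold)
  moreover have "(\<lambda>(i, j). f i j) ` (A \<times> B) \<subseteq> carrier E"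
    using pcm_sums_D(2)[OF r] by fastforce
  moreover have "r ` A \<subseteq> carrier E" using pcm_sums_D(3)[OF r] by blast
  ultimately show ?thesis using assms by (simp add: pcm_sums_iff)
qed

text \<open>Row and column sums have to exist, but neither total is presupposed: the iterated sums
  agree in the total monoid, even if both are \<open>None\<close>.\<close>

lemma pcm_sums_swap:
  assumes "finite A" "finite B"
    and r: "\<And>i. i \<in> A \<Longrightarrow> pcm_sums E (f i) B (r i)"
    and c: "\<And>j. j \<in> B \<Longrightarrow> pcm_sums E (\<lambda>i. f i j) A (c j)"
  shows "pcm_sums E r A s \<longleftrightarrow> pcm_sums E c B s"
proof -
  have "osum.F (\<lambda>i. Some (r i)) A = osum.F (\<lambda>i. osum.F (\<lambda>j. Some (f i j)) B) A"
    using pcm_sums_D(4)[OF r] by (intro osum.cong) auto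
  also have "\<dots> = osum.F (\<lambda>j. osum.F (\<lambda>i. Some (f i j)) A) B"
    by (rule osum.swap)
  also have "\<dots> = osum.F (\<lambda>j. Some (c j)) B"
    using pcm_sums_D(4)[OF c] by (intro osum.cong) auto
  finally have "osum.F (\<lambda>i. Some (r i)) A = osum.F (\<lambda>j. Some (c j)) B" .
  moreover have "r ` A \<subseteq> carrier E" using pcm_sums_D(3)[OF r] by blast
  moreover have "c ` B \<subseteq> carrier E" using pcm_sums_D(3)[OF c] by blast
  ultimately show ?thesis using assms by (simp add: pcm_sums_iff)
qed

end

text \<open>Applied to a bimorphism with one argument fixed, this is distributivity over finite
  sums, with definedness included.\<close>

lemma pcm_sums_hom:
  assumes "pcm_hom P Q k" "pcm_sums P f A s"
  shows "pcm_sums Q (\<lambda>i. k (f i)) A (k s)"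
  using assms(2)
proof induction
  case empty
  then show ?case using assms(1) pcm_sums.empty unfolding pcm_hom_def by metis
next
  case (insert A s i)
  then show ?case
    using assms(1) pcm_sums.insert[of Q "\<lambda>i. k (f i)" A "k s" i] unfolding pcm_hom_def by auto
qed

section \<open>Distributions over one effect algebra\<close>

context effect_algebra
begin

text \<open>Dropping zeros reduces the sum over A to the sum over the support;
  \<open>ea_le_one\<close> provides the bound.\<close>

lemma distI:
  assumes "\<Delta> \<in> X \<rightarrow>\<^sub>E carrier E" "supp E X \<Delta> \<subseteq> A" "A \<subseteq> X" "pcm_sums E \<Delta> A s"
  shows "\<Delta> \<in> dist E X"
proof -
  have "\<Delta> x = pzero E" if "x \<in> A - supp E X \<Delta>" for x
    using that assms(3) unfolding supp_def by blast
  then have "pcm_sums E \<Delta> (supp E X \<Delta>) s"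
    using pcm_sums_mono_neutral[OF pcm_sums_D(1)[OF assms(4)] assms(2)] assms(4) by blast
  moreover from this have "ea_le E s (one E)" by (intro ea_le_one pcm_sums_D(3))
  moreover have "finite (supp E X \<Delta>)"
    using pcm_sums_D(1)[OF calculation(1)] .
  ultimately show ?thesis using assms(1) unfolding dist_def by blast
qed

lemma dist_PiE: "\<Delta> \<in> dist E X \<Longrightarrow> \<Delta> \<in> X \<rightarrow>\<^sub>E carrier E"
  unfolding dist_def by blast

lemma dist_carrier: "\<Delta> \<in> dist E X \<Longrightarrow> x \<in> X \<Longrightarrow> \<Delta> x \<in> carrier E"
  using dist_PiE by blast

lemma finite_supp: "\<Delta> \<in> dist E X \<Longrightarrow> finite (supp E X \<Delta>)"
  unfolding dist_def by blast

lemma supp_subset: "supp E X \<Delta> \<subseteq> X"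
  unfolding supp_def by blast

lemma finite_UN_supp:
  "finite K \<Longrightarrow> K \<subseteq> dist E X \<Longrightarrow> finite (\<Union>\<Delta>\<in>K. supp E X \<Delta>)"
  using finite_supp by (intro finite_UN_I) blast+

lemma UN_supp_subset: "(\<Union>\<Delta>\<in>K. supp E X \<Delta>) \<subseteq> X"
  unfolding supp_def by blast

lemma not_in_supp: "x \<in> X \<Longrightarrow> x \<notin> supp E X \<Delta> \<Longrightarrow> \<Delta> x = pzero E"
  unfolding supp_def by blast

text \<open>Zeros extend the defined sum from the support to its union with A, and a subsum of a
  defined sum is defined.\<close>

lemma dist_pcm_sums:
  assumes "\<Delta> \<in> dist E X" "finite A" "A \<subseteq> X"
  shows "\<exists>s. pcm_sums E \<Delta> A s"
proof -
  obtain s where s: "pcm_sums E \<Delta> (supp E X \<Delta>) s"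
    using assms(1) unfolding dist_def by blast
  have "\<Delta> x = pzero E" if "x \<in> supp E X \<Delta> \<union> A - supp E X \<Delta>" for x
    using that assms(3) not_in_supp[of x X \<Delta>] by blast
  then have "pcm_sums E \<Delta> (supp E X \<Delta> \<union> A) s"
    using s assms(2) finite_supp[OF assms(1)]
      pcm_sums_mono_neutral[of "supp E X \<Delta> \<union> A" "supp E X \<Delta>" \<Delta> s] by blast
  then show ?thesis by (rule pcm_sums_subset) simp
qed

text \<open>Replaces the definite description in \<open>dist_map\<close> by a sum known to exist.
  The freedom in A permits index sets fitted to one point or shared by several
  distributions.\<close>

lemma dist_map_sums:
  assumes "\<Delta> \<in> dist E X" "y \<in> Y" "finite A" "supp E X \<Delta> \<subseteq> A" "A \<subseteq> X"
  shows "pcm_sums E \<Delta> {x \<in> A. f x = y} (dist_map E X Y f \<Delta> y)"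
proof -
  have "\<exists>s. pcm_sums E \<Delta> {x \<in> supp E X \<Delta>. f x = y} s"
    using assms(1) finite_supp[OF assms(1)] supp_subset[of X \<Delta>] by (intro dist_pcm_sums) auto
  then have "pcm_sums E \<Delta> {x \<in> supp E X \<Delta>. f x = y} (dist_map E X Y f \<Delta> y)"
    using assms pcm_sum_eq unfolding dist_map_def by force
  moreover have "\<Delta> x = pzero E" if "x \<in> {x \<in> A. f x = y} - {x \<in> supp E X \<Delta>. f x = y}" for x
    using that assms(5) not_in_supp[of x X \<Delta>] by blast
  moreover have "{x \<in> supp E X \<Delta>. f x = y} \<subseteq> {x \<in> A. f x = y}"
    using assms(4) by blast
  moreover have "finite {x \<in> A. f x = y}" using assms(3) by simp
  ultimately show ?thesis
    using pcm_sums_mono_neutral[of "{x \<in> A. f x = y}" "{x \<in> supp E X \<Delta>. f x = y}" \<Delta>]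
    by blast
qed

lemma dist_map_supp:
  assumes "\<Delta> \<in> dist E X" "supp E X \<Delta> \<subseteq> A" "A \<subseteq> X" "finite A"
  shows "supp E Y (dist_map E X Y f \<Delta>) \<subseteq> f ` A"
proof (rule subsetI, rule ccontr)
  fix y assume y: "y \<in> supp E Y (dist_map E X Y f \<Delta>)" "y \<notin> f ` A"
  then have "y \<in> Y" "{x \<in> A. f x = y} = {}" by (auto simp: supp_def)
  then have "pcm_sums E \<Delta> {} (dist_map E X Y f \<Delta> y)"
    using dist_map_sums[OF assms(1) _ assms(4,2,3), of y Y f] by metis
  then have "dist_map E X Y f \<Delta> y = pzero E"
    using pcm_sums.empty pcm_sums_unique by blast
  then show False using y(1) unfolding supp_def by simp
qed

lemma dist_map_closed:
  assumes "\<Delta> \<in> dist E X" "f \<in> X \<rightarrow>\<^sub>E Y"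
  shows "dist_map E X Y f \<Delta> \<in> dist E Y"
proof -
  let ?A = "supp E X \<Delta>"
  note A = finite_supp[OF assms(1)] supp_subset[of X \<Delta>]
  have s: "pcm_sums E \<Delta> {x \<in> ?A. f x = y} (dist_map E X Y f \<Delta> y)" if "y \<in> Y" for y
    using dist_map_sums[OF assms(1) that A(1) subset_refl A(2)] .
  obtain t where t: "pcm_sums E \<Delta> ?A t"
    using dist_pcm_sums[OF assms(1) A] by blast
  have fY: "f ` ?A \<subseteq> Y" using assms(2) A by auto
  have "dist_map E X Y f \<Delta> \<in> Y \<rightarrow>\<^sub>E carrier E"
    using pcm_sums_D(3)[OF s] assms(1) unfolding dist_map_def by auto
  \<comment> \<open>Grouping the support by the fibres of f shows that the push-forward has the same
    total t.\<close>
  moreover have "pcm_sums E (dist_map E X Y f \<Delta>) (f ` ?A) t"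
    using pcm_sums_group[of ?A "f ` ?A" f \<Delta> "dist_map E X Y f \<Delta>" t] s A t fY by blast
  ultimately show ?thesis
    using dist_map_supp[OF assms(1) subset_refl A(2,1)] fY by (intro distI)
qed

lemma dist_map_PiE: "f \<in> X \<rightarrow>\<^sub>E Y \<Longrightarrow> dist_map E X Y f \<in> dist E X \<rightarrow>\<^sub>E dist E Y"
  by (rule PiE_I, rule dist_map_closed) (simp_all add: dist_map_def)

lemma dist_ext:
  assumes "\<Delta> \<in> dist E X" "\<Gamma> \<in> dist E X" "\<And>x. x \<in> X \<Longrightarrow> \<Delta> x = \<Gamma> x"
  shows "\<Delta> = \<Gamma>"
  by (rule PiE_ext[OF dist_PiE[OF assms(1)] dist_PiE[OF assms(2)] assms(3)])

lemma dist_map_id: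
  assumes "\<Delta> \<in> dist E X"
  shows "dist_map E X X (\<lambda>x\<in>X. x) \<Delta> = \<Delta>"
proof (rule dist_ext)
  fix x assume x: "x \<in> X"
  \<comment> \<open>With x added, the fibre over x is exactly {x}, even when x lies outside the
    support.\<close>
  let ?A = "insert x (supp E X \<Delta>)"
  have "pcm_sums E \<Delta> {x' \<in> ?A. (\<lambda>x\<in>X. x) x' = x} (dist_map E X X (\<lambda>x\<in>X. x) \<Delta> x)"
    using x assms finite_supp[OF assms] supp_subset[of X \<Delta>] by (intro dist_map_sums) auto
  moreover have "{x' \<in> ?A. (\<lambda>x\<in>X. x) x' = x} = {x}"
    using x supp_subset[of X \<Delta>] by auto
  ultimately show "dist_map E X X (\<lambda>x\<in>X. x) \<Delta> x = \<Delta> x"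
    using dist_carrier[OF assms x] by (metis pcm_sums_singleton)
next
  show "dist_map E X X (\<lambda>x\<in>X. x) \<Delta> \<in> dist E X"
    using assms by (intro dist_map_closed) auto
qed (rule assms)

text \<open>The fibre of the composite over z is the disjoint union of the f-fibres over those y
  with g y = z, so the inner sums regroup along f.\<close>

lemma dist_map_compose:
  assumes "\<Delta> \<in> dist E X" "f \<in> X \<rightarrow>\<^sub>E Y" "g \<in> Y \<rightarrow>\<^sub>E Z"
  shows "dist_map E X Z (compose X g f) \<Delta> = dist_map E Y Z g (dist_map E X Y f \<Delta>)"
proof (rule dist_ext)
  show "dist_map E X Z (compose X g f) \<Delta> \<in> dist E Z"
    using assms by (intro dist_map_closed) (auto simp: compose_def)
  show "dist_map E Y Z g (dist_map E X Y f \<Delta>) \<in> dist E Z"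
    using assms by (intro dist_map_closed)
next
  fix z assume z: "z \<in> Z"
  let ?A = "supp E X \<Delta>"
  note A = finite_supp[OF assms(1)] supp_subset[of X \<Delta>]
  have fY: "f ` ?A \<subseteq> Y" using assms(2) A by auto
  have "pcm_sums E (dist_map E X Y f \<Delta>) {y \<in> f ` ?A. g y = z}
      (dist_map E Y Z g (dist_map E X Y f \<Delta>) z)"
    using A fY z assms dist_map_supp[OF assms(1) subset_refl A(2,1), of Y f]
    by (intro dist_map_sums dist_map_closed) auto
  moreover have "pcm_sums E \<Delta> {x \<in> {x \<in> ?A. g (f x) = z}. f x = y} (dist_map E X Y f \<Delta> y)"
    if y: "y \<in> {y \<in> f ` ?A. g y = z}" for y
  proof -
    have "pcm_sums E \<Delta> {x \<in> ?A. f x = y} (dist_map E X Y f \<Delta> y)"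
      using y fY A by (intro dist_map_sums assms) auto
    moreover have "{x \<in> {x \<in> ?A. g (f x) = z}. f x = y} = {x \<in> ?A. f x = y}"
      using y by auto
    ultimately show ?thesis by simp
  qed
  moreover have "finite {x \<in> ?A. g (f x) = z}" "finite {y \<in> f ` ?A. g y = z}"
    "f ` {x \<in> ?A. g (f x) = z} \<subseteq> {y \<in> f ` ?A. g y = z}"
    using A by auto
  ultimately have "pcm_sums E \<Delta> {x \<in> ?A. g (f x) = z}
      (dist_map E Y Z g (dist_map E X Y f \<Delta>) z)"
    using pcm_sums_group[of "{x \<in> ?A. g (f x) = z}" "{y \<in> f ` ?A. g y = z}" f \<Delta>
        "dist_map E X Y f \<Delta>"] by blast
  moreover have "pcm_sums E \<Delta> {x \<in> ?A. compose X g f x = z}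
      (dist_map E X Z (compose X g f) \<Delta> z)"
    using A z by (intro dist_map_sums assms) auto
  moreover have "{x \<in> ?A. compose X g f x = z} = {x \<in> ?A. g (f x) = z}"
    using A by (auto simp: compose_def)
  ultimately show "dist_map E X Z (compose X g f) \<Delta> z
      = dist_map E Y Z g (dist_map E X Y f \<Delta>) z"
    using pcm_sums_unique by metis
qed

section \<open>Point distributions\<close>

lemma dist_unit_closed:
  assumes "x \<in> X"
  shows "dist_unit E X x \<in> dist E X"
proof (rule distI)
  show "dist_unit E X x \<in> X \<rightarrow>\<^sub>E carrier E"
    using assms one_closed zero_closed unfolding dist_unit_def by auto
  then show "pcm_sums E (dist_unit E X x) {x} (dist_unit E X x x)"
    using assms PiE_mem pcm_sums_singleton by metis
qed (use assms in \<open>auto simp: supp_def dist_unit_def\<close>)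

text \<open>Only an inclusion: in the one-element effect algebra 1 = 0 and the support is
  empty.\<close>

lemma dist_unit_supp: "x \<in> X \<Longrightarrow> supp E X (dist_unit E X x) \<subseteq> {x}"
  by (auto simp: supp_def dist_unit_def)

lemma dist_unit_PiE: "dist_unit E X \<in> X \<rightarrow>\<^sub>E dist E X"
  by (rule PiE_I, erule dist_unit_closed) (simp add: dist_unit_def)

lemma dist_unit_natural:
  assumes "f \<in> X \<rightarrow>\<^sub>E Y" "x \<in> X"
  shows "dist_map E X Y f (dist_unit E X x) = dist_unit E Y (f x)"
proof (rule dist_ext)
  show "dist_map E X Y f (dist_unit E X x) \<in> dist E Y"
    using assms by (intro dist_map_closed dist_unit_closed)
  show "dist_unit E Y (f x) \<in> dist E Y"
    using assms by (intro dist_unit_closed) auto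
next
  fix y assume y: "y \<in> Y"
  have s: "pcm_sums E (dist_unit E X x) {x' \<in> {x}. f x' = y}
      (dist_map E X Y f (dist_unit E X x) y)"
    using assms y dist_unit_supp[OF assms(2)] by (intro dist_map_sums dist_unit_closed) auto
  have "pcm_sums E (dist_unit E X x) {x' \<in> {x}. f x' = y} (dist_unit E Y (f x) y)"
  proof (cases "f x = y")
    case True
    then have "{x' \<in> {x}. f x' = y} = {x}" "dist_unit E Y (f x) y = dist_unit E X x x"
      using assms y by (auto simp: dist_unit_def)
    then show ?thesis
      using pcm_sums_singleton dist_carrier[OF dist_unit_closed] assms(2) by metis
  next
    case False
    then have "{x' \<in> {x}. f x' = y} = {}" "dist_unit E Y (f x) y = pzero E"
      using assms y by (auto simp: dist_unit_def)
    then show ?thesis using pcm_sums.empty by metis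
  qed
  then show "dist_map E X Y f (dist_unit E X x) y = dist_unit E Y (f x) y"
    using s pcm_sums_unique by blast
qed

end

section \<open>Multiplication along a bimorphism\<close>

text \<open>One multiplication \<open>nabla m n\<close> detached from the grading: A, B, C stand for
  the algebras at grades m, n and m + n.\<close>

locale effect_bimorphism =
  A: effect_algebra A + B: effect_algebra B + C: effect_algebra C
  for A B C :: "('e, 's) effect_alg_scheme" +
  fixes h :: "'e \<Rightarrow> 'e \<Rightarrow> 'e"
  assumes bimorphism: "bimorphism A B C h"
begin

section \<open>Elementary laws of a bimorphism and definedness of its sums\<close>

lemma hom_right: "a \<in> carrier A \<Longrightarrow> pcm_hom B C (h a)"
  and hom_left: "b \<in> carrier B \<Longrightarrow> pcm_hom A C (\<lambda>a. h a b)"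
  using bimorphism unfolding bimorphism_def by auto

lemma closed: "a \<in> carrier A \<Longrightarrow> b \<in> carrier B \<Longrightarrow> h a b \<in> carrier C"
  using hom_right unfolding pcm_hom_def by blast

lemma zero_left: "b \<in> carrier B \<Longrightarrow> h (pzero A) b = pzero C"
  using hom_left unfolding pcm_hom_def by blast

lemma zero_right: "a \<in> carrier A \<Longrightarrow> h a (pzero B) = pzero C"
  using hom_right unfolding pcm_hom_def by blast

text \<open>Apply the homomorphism \<open>h a\<close> to the sum of b and its complement.\<close>

lemma le_one_right:
  assumes "a \<in> carrier A" "b \<in> carrier B"
  shows "ea_le C (h a b) (h a (one B))"
  using B.compl_add[OF assms(2)] hom_right[OF assms(1)] unfolding pcm_hom_def ea_le_def by metis

text \<open>
  Each inner sum is at most \<open>h (\<Phi> z) 1\<close>, and these upper bounds are summable over \<open>z\<close>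
  because \<open>h\<close> is additive in its first argument.
\<close>

lemma bind_summable:
  assumes \<Phi>: "\<Phi> \<in> dist A Z" and g: "\<And>z. z \<in> Z \<Longrightarrow> g z \<in> dist B X"
    and K: "finite K" "K \<subseteq> Z" and U: "finite U" "U \<subseteq> X"
  shows "\<exists>s. pcm_sums C (\<lambda>(z, x). h (\<Phi> z) (g z x)) (K \<times> U) s"
proof -
  obtain t where t: "pcm_sums A \<Phi> K t"
    using A.dist_pcm_sums[OF \<Phi> K] by blast
  obtain s where s: "\<And>z. z \<in> K \<Longrightarrow> pcm_sums B (g z) U (s z)"
    using B.dist_pcm_sums[OF g U] K by (metis subsetD)
  have \<Phi>_cl: "\<Phi> z \<in> carrier A" if "z \<in> K" for z
    using A.dist_carrier[OF \<Phi>] that K by blast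
  have s': "pcm_sums C (\<lambda>x. h (\<Phi> z) (g z x)) U (h (\<Phi> z) (s z))" if "z \<in> K" for z
    using pcm_sums_hom[OF hom_right[OF \<Phi>_cl[OF that]] s[OF that]] .
  have "pcm_sums C (\<lambda>z. h (\<Phi> z) (one B)) K (h t (one B))"
    using pcm_sums_hom[OF hom_left[OF B.one_closed] t] .
  then have "\<exists>r. pcm_sums C (\<lambda>z. h (\<Phi> z) (s z)) K r"
    using \<Phi>_cl B.pcm_sums_D(3)[OF s] le_one_right by (intro C.pcm_sums_summand_le) auto
  then show ?thesis
    using C.pcm_sums_Times[of K U "\<lambda>z x. h (\<Phi> z) (g z x)", OF K(1) U(1) s'] by blast
qed

lemma bind_summable_at:
  assumes "\<Phi> \<in> dist A Z" and "\<And>z. z \<in> Z \<Longrightarrow> g z \<in> dist B X"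
    and "finite K" "K \<subseteq> Z" "x \<in> X"
  shows "\<exists>s. pcm_sums C (\<lambda>z. h (\<Phi> z) (g z x)) K s"
proof -
  obtain s where s: "pcm_sums C (\<lambda>(z, x). h (\<Phi> z) (g z x)) (K \<times> {x}) s"
    using bind_summable[of \<Phi> Z g X K "{x}"] assms by blast
  have "h (\<Phi> z) (g z x) \<in> carrier C" if "z \<in> K" for z
    using that assms A.dist_carrier[OF assms(1)] B.dist_carrier[OF assms(2)]
    by (intro closed) auto
  then have "pcm_sums C (\<lambda>x. h (\<Phi> z) (g z x)) {x} (h (\<Phi> z) (g z x))" if "z \<in> K" for z
    using C.pcm_sums_singleton[of "\<lambda>x. h (\<Phi> z) (g z x)" x] that by simp
  then have "pcm_sums C (\<lambda>z. h (\<Phi> z) (g z x)) K s"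
    using C.pcm_sums_Times[of K "{x}" "\<lambda>z x. h (\<Phi> z) (g z x)" "\<lambda>z. h (\<Phi> z) (g z x)" s]
      assms(3) s by simp
  then show ?thesis by blast
qed

section \<open>Values, closure and naturality of the multiplication\<close>

abbreviation "mult \<equiv> dist_mult A B C h"

text \<open>The counterpart of \<open>dist_map_sums\<close>: the sum behind \<open>dist_mult\<close>
  exists by \<open>bind_summable_at\<close>, and points of K outside the support contribute h 0 _ =
  0.\<close>

lemma mult_sums:
  assumes \<Phi>: "\<Phi> \<in> dist A (dist B X)" and x: "x \<in> X"
    and K: "finite K" "supp A (dist B X) \<Phi> \<subseteq> K" "K \<subseteq> dist B X"
  shows "pcm_sums C (\<lambda>\<Delta>. h (\<Phi> \<Delta>) (\<Delta> x)) K (mult X \<Phi> x)"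
proof -
  have "\<exists>s. pcm_sums C (\<lambda>\<Delta>. h (\<Phi> \<Delta>) (\<Delta> x)) (supp A (dist B X) \<Phi>) s"
    using bind_summable_at[OF \<Phi>, of "\<lambda>\<Delta>. \<Delta>" X "supp A (dist B X) \<Phi>" x] x
      A.finite_supp[OF \<Phi>] A.supp_subset[of "dist B X" \<Phi>] by fast
  then have "pcm_sums C (\<lambda>\<Delta>. h (\<Phi> \<Delta>) (\<Delta> x)) (supp A (dist B X) \<Phi>) (mult X \<Phi> x)"
    using \<Phi> x C.pcm_sum_eq unfolding dist_mult_def by force
  moreover have "h (\<Phi> \<Delta>) (\<Delta> x) = pzero C" if "\<Delta> \<in> K - supp A (dist B X) \<Phi>" for \<Delta>
  proof -
    have "\<Delta> \<in> dist B X" using that K(3) by blast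
    then show ?thesis
      using that x A.not_in_supp[of \<Delta> "dist B X" \<Phi>] B.dist_carrier[of \<Delta> X x]
        zero_left[of "\<Delta> x"] by simp
  qed
  ultimately show ?thesis
    using C.pcm_sums_mono_neutral[OF K(1,2), of "\<lambda>\<Delta>. h (\<Phi> \<Delta>) (\<Delta> x)"] by blast
qed

lemma mult_closed_supp:
  assumes \<Phi>: "\<Phi> \<in> dist A (dist B X)"
    and K: "finite K" "supp A (dist B X) \<Phi> \<subseteq> K" "K \<subseteq> dist B X"
  shows "mult X \<Phi> \<in> dist C X"
    and "supp C X (mult X \<Phi>) \<subseteq> (\<Union>\<Delta>\<in>K. supp B X \<Delta>)"
proof -
  let ?U = "\<Union>\<Delta>\<in>K. supp B X \<Delta>"
  have U: "finite ?U" "?U \<subseteq> X"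
    using B.finite_UN_supp[OF K(1,3)] B.UN_supp_subset .
  note m = mult_sums[OF \<Phi> _ K]
  show supp: "supp C X (mult X \<Phi>) \<subseteq> ?U"
  proof (rule subsetI, rule ccontr)
    fix x assume x: "x \<in> supp C X (mult X \<Phi>)" "x \<notin> ?U"
    then have xX: "x \<in> X" unfolding supp_def by blast
    have "h (\<Phi> \<Delta>) (\<Delta> x) = pzero C" if "\<Delta> \<in> K" for \<Delta>
      using that K x xX B.not_in_supp[of x X \<Delta>] A.dist_carrier[OF \<Phi>] zero_right by auto
    then have "pcm_sums C (\<lambda>\<Delta>. h (\<Phi> \<Delta>) (\<Delta> x)) {} (mult X \<Phi> x)"
      using C.pcm_sums_mono_neutral[OF K(1), of "{}" "\<lambda>\<Delta>. h (\<Phi> \<Delta>) (\<Delta> x)"] m[OF xX] by blast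
    then have "mult X \<Phi> x = pzero C"
      using pcm_sums.empty C.pcm_sums_unique by blast
    then show False using x(1) unfolding supp_def by simp
  qed
  obtain s where s: "pcm_sums C (\<lambda>(\<Delta>, x). h (\<Phi> \<Delta>) (\<Delta> x)) (K \<times> ?U) s"
    using bind_summable[OF \<Phi>, of "\<lambda>\<Delta>. \<Delta>" X K ?U] K U by blast
  have "\<exists>r. pcm_sums C (\<lambda>x. h (\<Phi> \<Delta>) (\<Delta> x)) ?U r" if "\<Delta> \<in> K" for \<Delta>
  proof -
    have \<Delta>: "\<Delta> \<in> dist B X" using that K(3) by blast
    obtain t where "pcm_sums B \<Delta> ?U t" using B.dist_pcm_sums[OF \<Delta> U] by blast
    then show ?thesis
      using pcm_sums_hom[OF hom_right[OF A.dist_carrier[OF \<Phi> \<Delta>]]] by blast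
  qed
  then obtain r where r: "\<And>\<Delta>. \<Delta> \<in> K \<Longrightarrow> pcm_sums C (\<lambda>x. h (\<Phi> \<Delta>) (\<Delta> x)) ?U (r \<Delta>)"
    by metis
  \<comment> \<open>The total of the product comes from exchanging the double sum s: its rows add up
    to r \<Delta>, its columns to the values of \<open>mult X \<Phi>\<close>.\<close>
  have "pcm_sums C (mult X \<Phi>) ?U s"
  proof -
    have "pcm_sums C r K s"
      using C.pcm_sums_Times[of K ?U "\<lambda>\<Delta> x. h (\<Phi> \<Delta>) (\<Delta> x)" r, OF K(1) U(1) r] s by blast
    then show ?thesis
      using C.pcm_sums_swap[of K ?U "\<lambda>\<Delta> x. h (\<Phi> \<Delta>) (\<Delta> x)" r "mult X \<Phi>", OF K(1) U(1) r m]
        U(2) by blast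
  qed
  moreover have "mult X \<Phi> \<in> X \<rightarrow>\<^sub>E carrier C"
    using C.pcm_sums_D(3)[OF m] \<Phi> unfolding dist_mult_def by auto
  ultimately show "mult X \<Phi> \<in> dist C X"
    using supp U by (intro C.distI)
qed

lemma mult_closed: "\<Phi> \<in> dist A (dist B X) \<Longrightarrow> mult X \<Phi> \<in> dist C X"
  using mult_closed_supp(1)[OF _ A.finite_supp subset_refl A.supp_subset] .

lemma mult_PiE: "mult X \<in> dist A (dist B X) \<rightarrow>\<^sub>E dist C X"
  by (rule PiE_I, erule mult_closed) (simp add: dist_mult_def)

text \<open>The formula for Kleisli extension. Points z with equal g z are merged by the
  push-forward, and additivity of h in its first argument separates them again. Naturality,
  associativity and the right unit law all start from it.\<close>

lemma mult_map_sums: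
  assumes \<Phi>: "\<Phi> \<in> dist A Z" and g: "g \<in> Z \<rightarrow>\<^sub>E dist B X" and x: "x \<in> X"
    and K: "finite K" "supp A Z \<Phi> \<subseteq> K" "K \<subseteq> Z"
  shows "pcm_sums C (\<lambda>z. h (\<Phi> z) (g z x)) K (mult X (dist_map A Z (dist B X) g \<Phi>) x)"
proof -
  let ?\<Theta> = "dist_map A Z (dist B X) g \<Phi>"
  have gK: "g ` K \<subseteq> dist B X" using g K by auto
  have "pcm_sums C (\<lambda>\<Delta>. h (?\<Theta> \<Delta>) (\<Delta> x)) (g ` K) (mult X ?\<Theta> x)"
    using K(1) gK x A.dist_map_supp[OF \<Phi> K(2,3,1), of "dist B X" g]
    by (intro mult_sums A.dist_map_closed[OF \<Phi> g]) auto
  moreover have "pcm_sums C (\<lambda>z. h (\<Phi> z) (g z x)) {z \<in> K. g z = \<Delta>} (h (?\<Theta> \<Delta>) (\<Delta> x))"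
    if \<Delta>: "\<Delta> \<in> g ` K" for \<Delta>
  proof -
    have \<Delta>': "\<Delta> \<in> dist B X" using \<Delta> gK by blast
    have "pcm_sums C (\<lambda>z. h (\<Phi> z) (\<Delta> x)) {z \<in> K. g z = \<Delta>} (h (?\<Theta> \<Delta>) (\<Delta> x))"
      using pcm_sums_hom[OF hom_left[OF B.dist_carrier[OF \<Delta>' x]] A.dist_map_sums[OF \<Phi> \<Delta>' K]] .
    then show ?thesis
      using C.pcm_sums_cong[OF refl, of "{z \<in> K. g z = \<Delta>}" "\<lambda>z. h (\<Phi> z) (\<Delta> x)"
          "\<lambda>z. h (\<Phi> z) (g z x)"] by simp
  qed
  ultimately show ?thesis
    using C.pcm_sums_group[OF K(1) finite_imageI[OF K(1)] subset_refl, of g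
        "\<lambda>z. h (\<Phi> z) (g z x)" "\<lambda>\<Delta>. h (?\<Theta> \<Delta>) (\<Delta> x)"] by blast
qed

lemma mult_natural:
  assumes f: "f \<in> X \<rightarrow>\<^sub>E Y" and \<Phi>: "\<Phi> \<in> dist A (dist B X)"
  shows "dist_map C X Y f (mult X \<Phi>)
    = mult Y (dist_map A (dist B X) (dist B Y) (dist_map B X Y f) \<Phi>)"
proof (rule C.dist_ext)
  note g = B.dist_map_PiE[OF f]
  show "dist_map C X Y f (mult X \<Phi>) \<in> dist C Y"
    using f \<Phi> by (intro C.dist_map_closed mult_closed)
  show "mult Y (dist_map A (dist B X) (dist B Y) (dist_map B X Y f) \<Phi>) \<in> dist C Y"
    using g \<Phi> by (intro A.dist_map_closed mult_closed)
  fix y assume y: "y \<in> Y"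
  let ?K = "supp A (dist B X) \<Phi>"
  let ?U = "\<Union>\<Delta>\<in>?K. supp B X \<Delta>"
  note K = A.finite_supp[OF \<Phi>] subset_refl A.supp_subset[of "dist B X" \<Phi>]
  have U: "finite ?U" "?U \<subseteq> X"
    using B.finite_UN_supp[OF K(1,3)] B.UN_supp_subset .
  have l: "pcm_sums C (mult X \<Phi>) {x \<in> ?U. f x = y} (dist_map C X Y f (mult X \<Phi>) y)"
    using C.dist_map_sums[OF mult_closed[OF \<Phi>] y U(1) mult_closed_supp(2)[OF \<Phi> K] U(2)] .
  have r: "pcm_sums C (\<lambda>\<Delta>. h (\<Phi> \<Delta>) (dist_map B X Y f \<Delta> y)) ?K
      (mult Y (dist_map A (dist B X) (dist B Y) (dist_map B X Y f) \<Phi>) y)"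
    using mult_map_sums[OF \<Phi> g y K] .
  \<comment> \<open>Row sums of the matrix h (\<Phi> \<Delta>) (\<Delta> x): the homomorphism
    \<open>h (\<Phi> \<Delta>)\<close> carries over the fibre sum that defines the push-forward of
    \<Delta>. The columns are values of \<open>mult X \<Phi>\<close>.\<close>
  have "pcm_sums C (\<lambda>x. h (\<Phi> \<Delta>) (\<Delta> x)) {x \<in> ?U. f x = y} (h (\<Phi> \<Delta>) (dist_map B X Y f \<Delta> y))"
    if "\<Delta> \<in> ?K" for \<Delta>
    using that K U by (intro pcm_sums_hom[OF hom_right] A.dist_carrier[OF \<Phi>] B.dist_map_sums y) auto
  moreover have "finite {x \<in> ?U. f x = y}"
    using U(1) by (rule rev_finite_subset) blast
  moreover have "pcm_sums C (\<lambda>\<Delta>. h (\<Phi> \<Delta>) (\<Delta> x)) ?K (mult X \<Phi> x)"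
    if "x \<in> {x \<in> ?U. f x = y}" for x
    using that U(2) by (intro mult_sums[OF \<Phi> _ K]) blast
  ultimately have "pcm_sums C (mult X \<Phi>) {x \<in> ?U. f x = y}
      (mult Y (dist_map A (dist B X) (dist B Y) (dist_map B X Y f) \<Phi>) y)"
    using C.pcm_sums_swap[OF K(1), of "{x \<in> ?U. f x = y}" "\<lambda>\<Delta> x. h (\<Phi> \<Delta>) (\<Delta> x)"
        "\<lambda>\<Delta>. h (\<Phi> \<Delta>) (dist_map B X Y f \<Delta> y)" "mult X \<Phi>"]
      r by blast
  then show "dist_map C X Y f (mult X \<Phi>) y
      = mult Y (dist_map A (dist B X) (dist B Y) (dist_map B X Y f) \<Phi>) y"
    using l C.pcm_sums_unique by blast
qed

end

text \<open>Both sides are iterated sums of k (h (\<Phi> \<Psi>) (\<Psi> \<Delta>)) (\<Delta> x),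
  one by rows \<Psi> and the other by columns \<Delta>.\<close>

lemma mult_assoc:
  assumes AB: "effect_bimorphism A B AB h" and AB_C: "effect_bimorphism AB C ABC k"
    and BC: "effect_bimorphism B C BC h'" and A_BC: "effect_bimorphism A BC ABC k'"
    and assoc: "\<And>a b c. a \<in> carrier A \<Longrightarrow> b \<in> carrier B \<Longrightarrow> c \<in> carrier C \<Longrightarrow>
      k (h a b) c = k' a (h' b c)"
    and \<Phi>: "\<Phi> \<in> dist A (dist B (dist C X))"
  shows "dist_mult A BC ABC k' X
      (dist_map A (dist B (dist C X)) (dist BC X) (dist_mult B C BC h' X) \<Phi>)
    = dist_mult AB C ABC k X (dist_mult A B AB h (dist C X) \<Phi>)"
proof -
  interpret AB: effect_bimorphism A B AB h by (rule AB)
  interpret AB_C: effect_bimorphism AB C ABC k by (rule AB_C)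
  interpret BC: effect_bimorphism B C BC h' by (rule BC)
  interpret A_BC: effect_bimorphism A BC ABC k' by (rule A_BC)
  let ?Z = "dist B (dist C X)"
  note g = BC.mult_PiE[of X]
  let ?K = "supp A ?Z \<Phi>"
  \<comment> \<open>A single set covering the supports of all \<Psi> in \<open>?K\<close>, so that
    the terms form a rectangle.\<close>
  let ?U = "\<Union>\<Psi>\<in>?K. supp B (dist C X) \<Psi>"
  note K = AB.A.finite_supp[OF \<Phi>] subset_refl AB.A.supp_subset[of ?Z \<Phi>]
  have U: "finite ?U" "?U \<subseteq> dist C X"
    using AB.B.finite_UN_supp[OF K(1,3)] AB.B.UN_supp_subset .
  show ?thesis
  proof (rule AB_C.C.dist_ext)
    show "A_BC.mult X (dist_map A ?Z (dist BC X) (BC.mult X) \<Phi>) \<in> dist ABC X"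
      using g \<Phi> by (intro AB.A.dist_map_closed A_BC.mult_closed)
    show "AB_C.mult X (AB.mult (dist C X) \<Phi>) \<in> dist ABC X"
      using \<Phi> by (intro AB_C.mult_closed AB.mult_closed)
    fix x assume x: "x \<in> X"
    have l: "pcm_sums ABC (\<lambda>\<Psi>. k' (\<Phi> \<Psi>) (BC.mult X \<Psi> x)) ?K
        (A_BC.mult X (dist_map A ?Z (dist BC X) (BC.mult X) \<Phi>) x)"
      using A_BC.mult_map_sums[OF \<Phi> g x K] .
    have r: "pcm_sums ABC (\<lambda>\<Delta>. k (AB.mult (dist C X) \<Phi> \<Delta>) (\<Delta> x)) ?U
        (AB_C.mult X (AB.mult (dist C X) \<Phi>) x)"
      using AB_C.mult_sums[OF AB.mult_closed[OF \<Phi>] x U(1) AB.mult_closed_supp(2)[OF \<Phi> K] U(2)] .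
    \<comment> \<open>Rows: k' is additive in its second argument, and \<open>assoc\<close> rewrites
      the terms.\<close>
    have l': "pcm_sums ABC (\<lambda>\<Delta>. k (h (\<Phi> \<Psi>) (\<Psi> \<Delta>)) (\<Delta> x)) ?U (k' (\<Phi> \<Psi>) (BC.mult X \<Psi> x))"
      if \<Psi>: "\<Psi> \<in> ?K" for \<Psi>
    proof -
      have \<Psi>': "\<Psi> \<in> ?Z" using \<Psi> K by blast
      have \<Phi>\<Psi>: "\<Phi> \<Psi> \<in> carrier A" using AB.A.dist_carrier[OF \<Phi> \<Psi>'] .
      have "pcm_sums BC (\<lambda>\<Delta>. h' (\<Psi> \<Delta>) (\<Delta> x)) ?U (BC.mult X \<Psi> x)"
        using \<Psi> \<Psi>' U x by (intro BC.mult_sums) auto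
      then have *: "pcm_sums ABC (\<lambda>\<Delta>. k' (\<Phi> \<Psi>) (h' (\<Psi> \<Delta>) (\<Delta> x))) ?U (k' (\<Phi> \<Psi>) (BC.mult X \<Psi> x))"
        using pcm_sums_hom[OF A_BC.hom_right[OF \<Phi>\<Psi>]] by blast
      have "k (h (\<Phi> \<Psi>) (\<Psi> \<Delta>)) (\<Delta> x) = k' (\<Phi> \<Psi>) (h' (\<Psi> \<Delta>) (\<Delta> x))" if "\<Delta> \<in> ?U" for \<Delta>
        using that U x by (intro assoc \<Phi>\<Psi> AB.B.dist_carrier[OF \<Psi>'] AB_C.B.dist_carrier) auto
      then show ?thesis
        using * AB_C.C.pcm_sums_cong[OF refl, of ?U "\<lambda>\<Delta>. k (h (\<Phi> \<Psi>) (\<Psi> \<Delta>)) (\<Delta> x)"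
            "\<lambda>\<Delta>. k' (\<Phi> \<Psi>) (h' (\<Psi> \<Delta>) (\<Delta> x))"] by blast
    qed
    \<comment> \<open>Columns: k is additive in its first argument.\<close>
    have r': "pcm_sums ABC (\<lambda>\<Psi>. k (h (\<Phi> \<Psi>) (\<Psi> \<Delta>)) (\<Delta> x)) ?K
        (k (AB.mult (dist C X) \<Phi> \<Delta>) (\<Delta> x))" if "\<Delta> \<in> ?U" for \<Delta>
    proof -
      have \<Delta>: "\<Delta> \<in> dist C X" using that U by blast
      show ?thesis
        using pcm_sums_hom[OF AB_C.hom_left[OF AB_C.B.dist_carrier[OF \<Delta> x]]
            AB.mult_sums[OF \<Phi> \<Delta> K]] .
    qed
    show "A_BC.mult X (dist_map A ?Z (dist BC X) (BC.mult X) \<Phi>) x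
        = AB_C.mult X (AB.mult (dist C X) \<Phi>) x"
      using AB_C.C.pcm_sums_swap[OF K(1) U(1) l' r'] l r AB_C.C.pcm_sums_unique by blast
  qed
qed

text \<open>In the Kleisli formula with g the unit, every term with z different from x is h
  (\<Delta> z) 0 = 0. The index set contains x explicitly, since \<Delta> x may be zero.\<close>

lemma mult_map_unit:
  assumes "effect_bimorphism A B A h"
    and unit: "\<And>a. a \<in> carrier A \<Longrightarrow> h a (one B) = a"
    and \<Delta>: "\<Delta> \<in> dist A X"
  shows "dist_mult A B A h X (dist_map A X (dist B X) (dist_unit B X) \<Delta>) = \<Delta>"
proof -
  interpret effect_bimorphism A B A h by (rule assms(1))
  note g = B.dist_unit_PiE[of X]
  show ?thesis
  proof (rule A.dist_ext)
    show "mult X (dist_map A X (dist B X) (dist_unit B X) \<Delta>) \<in> dist A X"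
      using g \<Delta> by (intro A.dist_map_closed mult_closed)
    fix x assume x: "x \<in> X"
    let ?K = "insert x (supp A X \<Delta>)"
    have K: "finite ?K" "supp A X \<Delta> \<subseteq> ?K" "?K \<subseteq> X"
      using A.finite_supp[OF \<Delta>] A.supp_subset[of X \<Delta>] x by auto
    have "h (\<Delta> z) (dist_unit B X z x) = pzero A" if "z \<in> ?K - {x}" for z
      using that x K A.dist_carrier[OF \<Delta>] zero_right by (auto simp: dist_unit_def)
    then have "pcm_sums A (\<lambda>z. h (\<Delta> z) (dist_unit B X z x)) {x}
        (mult X (dist_map A X (dist B X) (dist_unit B X) \<Delta>) x)"
      using A.pcm_sums_mono_neutral[OF K(1), of "{x}" "\<lambda>z. h (\<Delta> z) (dist_unit B X z x)"]
        mult_map_sums[OF \<Delta> g x K] by blast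
    moreover have "h (\<Delta> x) (dist_unit B X x x) = \<Delta> x"
      using unit A.dist_carrier[OF \<Delta> x] x by (simp add: dist_unit_def)
    ultimately show "mult X (dist_map A X (dist B X) (dist_unit B X) \<Delta>) x = \<Delta> x"
      using A.dist_carrier[OF \<Delta> x] by (simp add: A.pcm_sums_singleton)
  qed (rule \<Delta>)
qed

lemma mult_unit:
  assumes "effect_bimorphism A B B h"
    and unit: "\<And>b. b \<in> carrier B \<Longrightarrow> h (one A) b = b"
    and \<Delta>: "\<Delta> \<in> dist B X"
  shows "dist_mult A B B h X (dist_unit A (dist B X) \<Delta>) = \<Delta>"
proof -
  interpret effect_bimorphism A B B h by (rule assms(1))
  show ?thesis
  proof (rule B.dist_ext)
    show "mult X (dist_unit A (dist B X) \<Delta>) \<in> dist B X"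
      using \<Delta> by (intro A.dist_unit_closed mult_closed)
    fix x assume x: "x \<in> X"
    have "pcm_sums B (\<lambda>\<Gamma>. h (dist_unit A (dist B X) \<Delta> \<Gamma>) (\<Gamma> x)) {\<Delta>}
        (mult X (dist_unit A (dist B X) \<Delta>) x)"
      using A.dist_unit_supp[OF \<Delta>] \<Delta> x by (intro mult_sums A.dist_unit_closed) auto
    moreover have "h (dist_unit A (dist B X) \<Delta> \<Delta>) (\<Delta> x) = \<Delta> x"
      using unit B.dist_carrier[OF \<Delta> x] \<Delta> by (simp add: dist_unit_def)
    ultimately show "mult X (dist_unit A (dist B X) \<Delta>) x = \<Delta> x"
      using B.dist_carrier[OF \<Delta> x] by (simp add: B.pcm_sums_singleton)
  qed (rule \<Delta>)
qed

section \<open>The graded monad\<close>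

lemma set_functor_dist:
  assumes "effect_algebra E"
  shows "set_functor (dist E) (dist E) (dist E)
    (dist_map E) (dist_map E) (dist_map E) (dist_map E)"
proof -
  interpret effect_algebra E by (rule assms)
  show ?thesis
    unfolding set_functor_def
  proof (intro conjI allI ballI)
    show "dist_map E X Y f \<in> dist E X \<rightarrow>\<^sub>E dist E Y" if "f \<in> X \<rightarrow>\<^sub>E Y" for X Y f
      by (rule dist_map_PiE[OF that])
    show "dist_map E X X (\<lambda>x\<in>X. x) = (\<lambda>u\<in>dist E X. u)" for X
      by (rule PiE_ext[OF dist_map_PiE]) (auto simp: dist_map_id)
    show "dist_map E X Z (compose X g f)
        = compose (dist E X) (dist_map E Y Z g) (dist_map E X Y f)"
      if "f \<in> X \<rightarrow>\<^sub>E Y" "g \<in> Y \<rightarrow>\<^sub>E Z" for X Y Z f g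
      using dist_map_compose[OF _ that] that
      by (intro PiE_ext[OF dist_map_PiE]) (auto simp: compose_def intro!: dist_map_closed)
  qed
qed

lemma natural_trans_dist_unit:
  assumes "effect_algebra E"
  shows "natural_trans (\<lambda>X. X) (\<lambda>Y. Y) (\<lambda>X Y f. f) (dist E) (dist E) (dist_map E)
    (dist_unit E) (dist_unit E)"
proof -
  interpret effect_algebra E by (rule assms)
  show ?thesis
    unfolding natural_trans_def
  proof (intro conjI allI ballI)
    show "dist_unit E X \<in> X \<rightarrow>\<^sub>E dist E X" for X
      by (rule dist_unit_PiE)
    \<comment> \<open>The component at the second object, whose type is a separate variable.\<close>
    show "dist_unit E X \<in> X \<rightarrow>\<^sub>E dist E X" for X
      by (rule dist_unit_PiE)
    show "compose X (dist_map E X Y f) (dist_unit E X) = compose X (dist_unit E Y) f"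
      if "f \<in> X \<rightarrow>\<^sub>E Y" for X Y f
      using dist_unit_natural[OF that] by (auto simp: compose_def fun_eq_iff)
  qed
qed

lemma (in effect_bimorphism) natural_trans_dist_mult:
  "natural_trans (\<lambda>X. dist A (dist B X)) (\<lambda>Y. dist A (dist B Y))
    (\<lambda>X Y f. dist_map A (dist B X) (dist B Y) (dist_map B X Y f))
    (dist C) (dist C) (dist_map C) mult mult"
  unfolding natural_trans_def
proof (intro conjI allI ballI)
  show "mult X \<in> dist A (dist B X) \<rightarrow>\<^sub>E dist C X" for X
    by (rule mult_PiE)
  show "mult X \<in> dist A (dist B X) \<rightarrow>\<^sub>E dist C X" for X
    by (rule mult_PiE)
  show "compose (dist A (dist B X)) (dist_map C X Y f) (mult X)
      = compose (dist A (dist B X)) (mult Y)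
          (dist_map A (dist B X) (dist B Y) (dist_map B X Y f))"
    if "f \<in> X \<rightarrow>\<^sub>E Y" for X Y f
    using mult_natural[OF that] by (auto simp: compose_def fun_eq_iff)
qed

context graded_effect_monoid
begin

lemma effect_bimorphism:
  assumes "orth M m n"
  shows "effect_bimorphism (E m) (E n) (E (add M m n)) (nabla m n)"
  using assms effect_algebra orth_carrier add_closed nabla_bimorphism
  by (simp add: effect_bimorphism_def effect_bimorphism_axioms_def)

text \<open>Links the unit laws, phrased with \<open>eta True\<close>, to \<open>dist_unit\<close>,
  which uses \<open>one\<close>: an effect morphism preserves 0 and complements, hence 1.\<close>

lemma eta_True: "eta True = one (E (pzero M))"
proof -
  have "eta False = pzero (E (pzero M))"
    using eta_morphism unfolding effect_morphism_def pcm_hom_def two_def by simp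
  moreover have "False \<in> carrier two" "compl two False = True"
    by (simp_all add: two_def)
  then have "eta True = compl (E (pzero M)) (eta False)"
    using eta_morphism unfolding effect_morphism_def by metis
  ultimately show ?thesis by (simp add: one_def)
qed

end

text \<open>\<open>pcm_sum\<close> is a definite description and has some value even where no sum
  exists. The last two conjuncts certify that the sums defining the action on functions and the
  multiplication do exist.\<close>

theorem mainTheorem2:
  fixes M :: "('m, 'r) pcm_scheme"
    and E :: "'m \<Rightarrow> ('e, 's) effect_alg_scheme"
    and nabla :: "'m \<Rightarrow> 'm \<Rightarrow> 'e \<Rightarrow> 'e \<Rightarrow> 'e"
    and eta :: "bool \<Rightarrow> 'e"
  assumes "graded_effect_monoid M E nabla eta"
  shows
    "graded_monad M
       (D E :: 'm \<Rightarrow> 'a set \<Rightarrow> ('a \<Rightarrow> 'e) set)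
       (D E :: 'm \<Rightarrow> 'b set \<Rightarrow> ('b \<Rightarrow> 'e) set)
       (D E :: 'm \<Rightarrow> 'c set \<Rightarrow> ('c \<Rightarrow> 'e) set)
       (D E) (D E) (D E)
       (D_map E) (D_map E) (D_map E) (D_map E) (D_map E) (D_map E) (D_map E)
       (D_unit M E) (D_unit M E) (D_unit M E)
       (D_mult M E nabla) (D_mult M E nabla) (D_mult M E nabla)
     \<and> (\<forall>m\<in>carrier M. \<forall>(X :: 'a set) (Y :: 'b set). \<forall>f \<in> X \<rightarrow>\<^sub>E Y. \<forall>\<Delta> \<in> D E m X. \<forall>y\<in>Y.
          pcm_sums (E m) \<Delta> {x \<in> supp (E m) X \<Delta>. f x = y} (D_map E m X Y f \<Delta> y))
     \<and> (\<forall>m n. orth M m n \<longrightarrow> (\<forall>(X :: 'a set). \<forall>\<Phi> \<in> D E m (D E n X). \<forall>x\<in>X.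
          pcm_sums (E (add M m n)) (\<lambda>\<Delta>. nabla m n (\<Phi> \<Delta>) (\<Delta> x)) (supp (E m) (D E n X) \<Phi>)
            (D_mult M E nabla m n X \<Phi> x)))"
proof -
  interpret graded_effect_monoid M E nabla eta by (rule assms)
  note D_defs = D_def D_map_def D_unit_def D_mult_def
  have "graded_monad M
       (D E :: 'm \<Rightarrow> 'a set \<Rightarrow> ('a \<Rightarrow> 'e) set)
       (D E :: 'm \<Rightarrow> 'b set \<Rightarrow> ('b \<Rightarrow> 'e) set)
       (D E :: 'm \<Rightarrow> 'c set \<Rightarrow> ('c \<Rightarrow> 'e) set)
       (D E) (D E) (D E)
       (D_map E) (D_map E) (D_map E) (D_map E) (D_map E) (D_map E) (D_map E)
       (D_unit M E) (D_unit M E) (D_unit M E)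
       (D_mult M E nabla) (D_mult M E nabla) (D_mult M E nabla)"
    unfolding graded_monad_def
  proof (intro conjI allI impI ballI; (elim conjE)?)
    show "partial_comm_monoid M" by unfold_locales
  next
    fix m assume "m \<in> carrier M"
    then show "set_functor (D E m :: 'a set \<Rightarrow> _) (D E m :: 'b set \<Rightarrow> _) (D E m :: 'c set \<Rightarrow> _)
        (D_map E m) (D_map E m) (D_map E m) (D_map E m)"
      unfolding D_defs by (intro set_functor_dist effect_algebra)
  next
    show "natural_trans (\<lambda>X. X) (\<lambda>Y. Y) (\<lambda>X Y f. f)
        (D E (pzero M) :: 'a set \<Rightarrow> _) (D E (pzero M) :: 'b set \<Rightarrow> _) (D_map E (pzero M))
        (D_unit M E) (D_unit M E)"
      unfolding D_defs by (intro natural_trans_dist_unit effect_algebra zero_closed)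
  next
    fix m n assume "orth M m n"
    then show "natural_trans (\<lambda>X :: 'a set. D E m (D E n X)) (\<lambda>Y :: 'b set. D E m (D E n Y))
        (\<lambda>X Y f. D_map E m (D E n X) (D E n Y) (D_map E n X Y f))
        (D E (add M m n)) (D E (add M m n)) (D_map E (add M m n))
        (D_mult M E nabla m n) (D_mult M E nabla m n)"
      unfolding D_defs
      by (intro effect_bimorphism.natural_trans_dist_mult effect_bimorphism)
  next
    fix m n p and X :: "'a set"
    assume np: "orth M n p" and m: "orth M m (add M n p)"
    \<comment> \<open>Identifies the grades (m + n) + p and m + (n + p), so that both composites
      take values in the same effect algebra.\<close>
    note a = assoc[OF np m]
    have "dist_mult (E m) (E (add M n p)) (E (add M m (add M n p))) (nabla m (add M n p)) X
          (dist_map (E m) (dist (E n) (dist (E p) X)) (dist (E (add M n p)) X)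
            (dist_mult (E n) (E p) (E (add M n p)) (nabla n p) X) \<Phi>)
        = dist_mult (E (add M m n)) (E p) (E (add M m (add M n p))) (nabla (add M m n) p) X
          (dist_mult (E m) (E n) (E (add M m n)) (nabla m n) (dist (E p) X) \<Phi>)"
      if "\<Phi> \<in> dist (E m) (dist (E n) (dist (E p) X))" for \<Phi>
      using effect_bimorphism[of "add M m n" p] a
      by (intro mult_assoc effect_bimorphism nabla_assoc that np m) auto
    then show "compose (D E m (D E n (D E p X))) (D_mult M E nabla m (add M n p) X)
          (D_map E m (D E n (D E p X)) (D E (add M n p) X) (D_mult M E nabla n p X)) =
        compose (D E m (D E n (D E p X))) (D_mult M E nabla (add M m n) p X)
          (D_mult M E nabla m n (D E p X))"
      using a unfolding D_defs by (auto simp: compose_def fun_eq_iff)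
  next
    fix m and X :: "'a set" assume m: "m \<in> carrier M"
    \<comment> \<open>The equation m + 0 = m lets the target of the multiplication be read as
      \<open>E m\<close>, the form that \<open>mult_map_unit\<close> requires.\<close>
    have r: "orth M m (pzero M)" "add M m (pzero M) = m"
      using zero_left[OF m] commute by metis+
    have "dist_mult (E m) (E (pzero M)) (E m) (nabla m (pzero M)) X
        (dist_map (E m) X (dist (E (pzero M)) X) (dist_unit (E (pzero M)) X) \<Delta>) = \<Delta>"
      if "\<Delta> \<in> dist (E m) X" for \<Delta>
      using effect_bimorphism[OF r(1)] r(2) nabla_unit_right[OF m]
      by (intro mult_map_unit that) (auto simp: eta_True)
    then show "compose (D E m X) (D_mult M E nabla m (pzero M) X)
        (D_map E m X (D E (pzero M) X) (D_unit M E X)) = (\<lambda>u\<in>D E m X. u)"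
      using r unfolding D_defs by (auto simp: compose_def fun_eq_iff)
  next
    fix m and X :: "'a set" assume m: "m \<in> carrier M"
    note l = zero_left[OF m]
    have "dist_mult (E (pzero M)) (E m) (E m) (nabla (pzero M) m) X
        (dist_unit (E (pzero M)) (dist (E m) X) \<Delta>) = \<Delta>"
      if "\<Delta> \<in> dist (E m) X" for \<Delta>
      using effect_bimorphism[of "pzero M" m] l nabla_unit_left[OF m]
      by (intro mult_unit that) (auto simp: eta_True)
    then show "compose (D E m X) (D_mult M E nabla (pzero M) m X) (D_unit M E (D E m X))
        = (\<lambda>u\<in>D E m X. u)"
      using l unfolding D_defs by (auto simp: compose_def fun_eq_iff)
  qed
  moreover have "pcm_sums (E m) \<Delta> {x \<in> supp (E m) X \<Delta>. f x = y} (D_map E m X Y f \<Delta> y)"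
    if "m \<in> carrier M" "\<Delta> \<in> D E m X" "y \<in> Y"
    for m and X :: "'a set" and Y :: "'b set" and f \<Delta> y
  proof -
    interpret Em: effect_algebra "E m" by (rule effect_algebra[OF that(1)])
    show ?thesis
      using that(2) unfolding D_defs
      by (intro Em.dist_map_sums that(3) Em.finite_supp Em.supp_subset subset_refl)
  qed
  moreover have "pcm_sums (E (add M m n)) (\<lambda>\<Delta>. nabla m n (\<Phi> \<Delta>) (\<Delta> x))
      (supp (E m) (D E n X) \<Phi>) (D_mult M E nabla m n X \<Phi> x)"
    if "orth M m n" "\<Phi> \<in> D E m (D E n X)" "x \<in> X" for m n and X :: "'a set" and \<Phi> x
  proof -
    interpret b: effect_bimorphism "E m" "E n" "E (add M m n)" "nabla m n"
      by (rule effect_bimorphism[OF that(1)])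
    show ?thesis
      using that(2) unfolding D_defs
      by (intro b.mult_sums that(3) b.A.finite_supp b.A.supp_subset subset_refl)
  qed
  ultimately show ?thesis
    by (intro conjI allI ballI impI)
qed

end
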